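(* Let $k>0$ be an integer. If $G$ is a finite graph with $2k-2<{\rm mad}(G)\le 2k$, then \[ {\rm col}(G^{2})\le (2k-1)\Delta(G)+2k+1, \] where $\Delta(G)$ is the maximum degree of $G$.
   Context: The maximum average degree is ${\rm mad}(G)=\max_{\emptyset\ne H\subseteq G}\frac{2\|H\|}{|H|}$ (number of edges over number of vertices). The square $G^{2}$ of $G=(V,E)$ is the graph on $V$ in which $x\ne y$ are adjacent iff their distance in $G$ is at most $2$. For a graph $H$, the coloring number is ${\rm col}(H)=\min_{\sigma}\max_{x\in V(H)}|N_H[x]\cap\{y: y\le_\sigma x\}|$, where $\sigma$ ranges over total orderings of $V(H)$ and $N_H[x]$ is the closed neighborhood of $x$ in $H$. *)

theory Defs
  imports Complex_Main "HOL-Library.Extended_Nat"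
begin

record 'a ugraph =
  verts :: "'a set"
  edges :: "'a set set"

definition simple_graph :: "'a ugraph \<Rightarrow> bool" where
  "simple_graph G \<longleftrightarrow> (\<forall>e\<in>edges G. e \<subseteq> verts G \<and> card e = 2)"

definition finite_graph :: "'a ugraph \<Rightarrow> bool" where
  "finite_graph G \<longleftrightarrow> simple_graph G \<and> finite (verts G)"

definition subgraph :: "'a ugraph \<Rightarrow> 'a ugraph \<Rightarrow> bool" where
  "subgraph H G \<longleftrightarrow> simple_graph H \<and> verts H \<subseteq> verts G \<and> edges H \<subseteq> edges G"

definition neighbors :: "'a ugraph \<Rightarrow> 'a \<Rightarrow> 'a set" where
  "neighbors G x = {y \<in> verts G. {x, y} \<in> edges G}"

definition closed_neighbors :: "'a ugraph \<Rightarrow> 'a \<Rightarrow> 'a set" where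
  "closed_neighbors G x = insert x (neighbors G x)"

definition degree :: "'a ugraph \<Rightarrow> 'a \<Rightarrow> nat" where
  "degree G x = card (neighbors G x)"

text \<open>The maxima below range over empty sets when the graph has no vertices; all three
  parameters are then set to 0.\<close>

definition max_degree :: "'a ugraph \<Rightarrow> nat" where
  "max_degree G = (if verts G = {} then 0 else Max (degree G ` verts G))"

definition mad :: "'a ugraph \<Rightarrow> real" where
  "mad G = (if verts G = {} then 0
     else Max {2 * real (card (edges H)) / real (card (verts H)) | H.
                 subgraph H G \<and> verts H \<noteq> {}})"

text \<open>A pair \<open>(y, x) \<in> r\<close> means that \<open>y\<close> is at most \<open>x\<close> in the ordering \<open>r\<close>.\<close>

definition col :: "'a ugraph \<Rightarrow> nat" where
  "col H = (if verts H = {} then 0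
     else Min {Max ((\<lambda>x. card (closed_neighbors H x \<inter> {y. (y, x) \<in> r})) ` verts H) | r.
                 linear_order_on (verts H) r})"

definition walk :: "'a ugraph \<Rightarrow> 'a list \<Rightarrow> bool" where
  "walk G p \<longleftrightarrow>
     p \<noteq> [] \<and> set p \<subseteq> verts G \<and> successively (\<lambda>u v. {u, v} \<in> edges G) p"

text \<open>The infimum of the empty set is \<open>\<infinity>\<close>, the distance between different components.\<close>

definition distance :: "'a ugraph \<Rightarrow> 'a \<Rightarrow> 'a \<Rightarrow> enat" where
  "distance G x y = (INF p \<in> {p. walk G p \<and> hd p = x \<and> last p = y}. enat (length p - 1))"

definition square :: "'a ugraph \<Rightarrow> 'a ugraph" where
  "square G = \<lparr>verts = verts G,
     edges = {{x, y} | x y. x \<in> verts G \<and> y \<in> verts G \<and> x \<noteq> y \<and> distance G x y \<le> 2}\<rparr>"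

end

theory Submission
  imports Defs
begin

text \<open>
  By the greedy ordering it suffices that every nonempty set \<open>X\<close> of vertices contains a vertex
  of degree at most \<open>(2k-1)\<Delta> + 2k\<close> in the subgraph of the square induced by \<open>X\<close>, and this is
  shown by averaging over \<open>X\<close>. The bound on the maximum average degree gives that there are at
  most \<open>k(|S| + |T|)\<close> adjacent pairs in \<open>S \<times> T\<close>: the edges meeting these pairs lie in \<open>S \<union> T\<close>,
  and those counted twice lie in \<open>S \<inter> T\<close>. Write \<open>d y\<close> for the number of neighbors of \<open>y\<close> in
  \<open>X\<close>. Then the degrees sum up to at most \<open>2k|X| + (\<Sum>y. d y (d y - 1))\<close>. Split
  \<open>d y - 1 \<le> (k - 1) + max 0 (d y - k)\<close>. The first part contributes at most \<open>(k-1)\<Delta>|X|\<close>. Since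
  \<open>d y \<le> \<Delta>\<close>, the second one contributes at most \<open>\<Delta>\<close> times the sum of \<open>d y - k\<close> over
  \<open>T = {y. d y > k}\<close>, which is at most \<open>k|X|\<close> by the bound on pairs in \<open>X \<times> T\<close>.
\<close>

section \<open>Edge counts from the maximum average degree\<close>

lemma finite_edges:
  assumes "finite_graph G"
  shows "finite (edges G)"
proof (rule finite_subset)
  show "edges G \<subseteq> Pow (verts G)"
    using assms by (auto simp: finite_graph_def simple_graph_def)
  show "finite (Pow (verts G))"
    using assms by (auto simp: finite_graph_def)
qed

lemma finite_neighbors:
  "finite_graph G \<Longrightarrow> finite (neighbors G x)"
  by (simp add: finite_graph_def neighbors_def)

lemma neighbors_sym:
  assumes "x \<in> verts G"
  shows "y \<in> neighbors G x \<Longrightarrow> x \<in> neighbors G y"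
  using assms by (auto simp: neighbors_def insert_commute)

text \<open>For nonempty \<open>W\<close>, the sets \<open>W\<close> and \<open>F\<close> form a
  subgraph that competes in the maximum defining \<open>mad\<close>. The product form also covers
  empty \<open>W\<close>, where no edge fits.\<close>

lemma card_edges_le_mad:
  assumes G: "finite_graph G" and W: "W \<subseteq> verts G" and F: "F \<subseteq> edges G" "F \<subseteq> Pow W"
  shows "2 * real (card F) \<le> mad G * real (card W)"
proof (cases "W = {}")
  case True
  then have "F \<subseteq> {{}}"
    using F by auto
  moreover have "{} \<notin> F"
    using F G by (force simp: finite_graph_def simple_graph_def)
  ultimately have "F = {}"
    by auto
  then show ?thesis
    using True by simp
next
  case False
  define q :: "'a set \<times> 'a set set \<Rightarrow> real"
    where "q = (\<lambda>(V, E). 2 * real (card E) / real (card V))"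
  define A where "A = {2 * real (card (edges H)) / real (card (verts H)) | H.
                 subgraph H G \<and> verts H \<noteq> {}}"
  have fin: "finite (verts G)" "finite (edges G)"
    using G finite_edges by (auto simp: finite_graph_def)
  \<comment> \<open>\<open>Max\<close> bounds its members only for a finite set, so the quotients
    are parametrized by pairs of subsets.\<close>
  have "A \<subseteq> q ` (Pow (verts G) \<times> Pow (edges G))"
    by (force simp: A_def q_def subgraph_def)
  then have "finite A"
    by (rule finite_subset) (use fin in auto)
  moreover have "2 * real (card F) / real (card W) \<in> A"
  proof -
    have "subgraph \<lparr>verts = W, edges = F\<rparr> G"
      using G W F by (auto simp: subgraph_def simple_graph_def finite_graph_def)
    then show ?thesis
      using False by (force simp: A_def)
  qed
  moreover have "mad G = Max A"
    using False W by (auto simp: mad_def A_def)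
  ultimately have "2 * real (card F) / real (card W) \<le> mad G"
    by simp
  moreover have "card W > 0"
    using False W fin by (simp add: card_gt_0_iff finite_subset)
  ultimately show ?thesis
    by (simp add: field_simps)
qed

lemma card_adjacent_pairs_le_mad:
  assumes G: "finite_graph G" and mad: "mad G \<le> 2 * real k"
    and S: "S \<subseteq> verts G" and T: "T \<subseteq> verts G"
  shows "card {(x, y) \<in> S \<times> T. {x, y} \<in> edges G} \<le> k * (card S + card T)"
proof -
  have fin: "finite S" "finite T"
    using G S T by (auto simp: finite_graph_def intro: finite_subset)
  have edge: "card F \<le> k * card W" if "W \<subseteq> verts G" "F \<subseteq> edges G" "F \<subseteq> Pow W" for F W
  proof -
    have "2 * real (card F) \<le> mad G * real (card W)"
      using card_edges_le_mad[OF G that] .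
    also have "\<dots> \<le> 2 * real k * real (card W)"
      using mad by (intro mult_right_mono) auto
    finally have "real (card F) \<le> real (k * card W)"
      by simp
    then show ?thesis
      by linarith
  qed
  \<comment> \<open>An arbitrary injective labelling, used only to select one of the two
    orientations of each edge inside \<open>S \<inter> T\<close>; \<open>P2\<close> collects the
    selected pairs.\<close>
  obtain f :: "'a \<Rightarrow> nat" where f: "inj_on f (S \<inter> T)"
    using finite_imp_inj_to_nat_seg[of "S \<inter> T"] fin by auto
  define P where "P = {(x, y) \<in> S \<times> T. {x, y} \<in> edges G}"
  define P2 where "P2 = {(x, y) \<in> P. x \<in> S \<inter> T \<and> y \<in> S \<inter> T \<and> f x < f y}"
  define e :: "'a \<times> 'a \<Rightarrow> 'a set" where "e = (\<lambda>(x, y). {x, y})"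
  have irrefl: "(x, x) \<notin> P" for x
    using G by (auto simp: P_def finite_graph_def simple_graph_def)
  have finP: "finite P"
    by (rule finite_subset[of _ "S \<times> T"]) (use fin in \<open>auto simp: P_def\<close>)
  have "inj_on e P2"
    by (auto simp: inj_on_def e_def P2_def doubleton_eq_iff)
  then have "card P2 = card (e ` P2)"
    by (simp add: card_image)
  also have "\<dots> \<le> k * card (S \<inter> T)"
    by (rule edge) (use S in \<open>auto simp: e_def P2_def P_def\<close>)
  finally have 2: "card P2 \<le> k * card (S \<inter> T)" .
  \<comment> \<open>Two distinct pairs with the same edge are reversals of each other, so both ends
    lie in \<open>S \<inter> T\<close> and one of the pairs belongs to \<open>P2\<close>.\<close>
  have "inj_on e (P - P2)"
  proof (rule inj_onI, clarify)
    fix x y x' y'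
    assume *: "(x, y) \<in> P" "(x, y) \<notin> P2" "(x', y') \<in> P" "(x', y') \<notin> P2" "e (x, y) = e (x', y')"
    show "x = x' \<and> y = y'"
    proof (rule ccontr)
      assume "\<not> ?thesis"
      then have eq: "x' = y" "y' = x"
        using *(5) by (auto simp: e_def doubleton_eq_iff)
      then have "x \<in> S \<inter> T" "y \<in> S \<inter> T" "x \<noteq> y"
        using *(1,3) irrefl by (auto simp: P_def)
      moreover from this have "f x \<noteq> f y"
        using f by (auto dest: inj_onD)
      ultimately show False
        using * eq by (auto simp: P2_def)
    qed
  qed
  then have "card (P - P2) = card (e ` (P - P2))"
    by (simp add: card_image)
  also have "\<dots> \<le> k * card (S \<union> T)"
    by (rule edge) (use S T in \<open>auto simp: e_def P_def\<close>)
  finally have 1: "card (P - P2) \<le> k * card (S \<union> T)" .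
  have "P2 \<subseteq> P"
    by (auto simp: P2_def)
  then have "card P = card (P - P2) + card P2"
    using finP by (metis card_Diff_subset card_mono finite_subset le_add_diff_inverse2)
  also have "\<dots> \<le> k * (card (S \<union> T) + card (S \<inter> T))"
    using 1 2 by (simp add: algebra_simps)
  also have "\<dots> = k * (card S + card T)"
    using card_Un_Int[OF fin] by simp
  finally show ?thesis
    by (simp add: P_def)
qed

text \<open>Counts the adjacent pairs by their end in \<open>T\<close>. It serves twice below: with
  both sets equal to \<open>X\<close>, and with \<open>T\<close> the vertices having more than
  \<open>k\<close> neighbors in \<open>X\<close>.\<close>

lemma sum_card_neighbors_le_mad:
  assumes G: "finite_graph G" and mad: "mad G \<le> 2 * real k"
    and S: "S \<subseteq> verts G" and T: "T \<subseteq> verts G"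
  shows "(\<Sum>y\<in>T. card (neighbors G y \<inter> S)) \<le> k * (card S + card T)"
proof -
  have fin: "finite T"
    using G T by (auto simp: finite_graph_def intro: finite_subset)
  have "(\<Sum>y\<in>T. card (neighbors G y \<inter> S)) = card (SIGMA y:T. neighbors G y \<inter> S)"
    using fin G by (simp add: card_SigmaI finite_neighbors)
  also have "(SIGMA y:T. neighbors G y \<inter> S) = {(x, y) \<in> T \<times> S. {x, y} \<in> edges G}"
    using S by (auto simp: neighbors_def)
  finally show ?thesis
    using card_adjacent_pairs_le_mad[OF G mad T S] by (simp add: add.commute)
qed

section \<open>Degrees in the square\<close>

lemma degree_le_max_degree:
  assumes "finite_graph G" "x \<in> verts G"
  shows "degree G x \<le> max_degree G"
  using assms by (auto simp: max_degree_def finite_graph_def)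

text \<open>A walk with at most two steps has at most three vertices. Removing \<open>x\<close> from
  the second neighborhoods saves one per middle vertex \<open>y\<close>.\<close>

lemma neighbors_square_subset:
  "neighbors (square G) x \<subseteq> neighbors G x \<union> (\<Union>y\<in>neighbors G x. neighbors G y - {x})"
proof
  fix z
  assume "z \<in> neighbors (square G) x"
  then obtain a b where ab: "{x, z} = {a, b}" "a \<noteq> b" "distance G a b \<le> 2"
    by (auto simp: neighbors_def square_def)
  \<comment> \<open>A strict bound on the infimum yields an actual walk below it.\<close>
  from ab(3) have "distance G a b < 3"
    by (rule order.strict_trans1) simp
  then obtain p where p: "walk G p" "hd p = a" "last p = b" "enat (length p - 1) < 3"
    by (auto simp: distance_def INF_less_iff)
  then have "length p \<noteq> 0" "length p - 1 < 3"
    by (auto simp: walk_def numeral_eq_enat)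
  then have "length p = 1 \<or> length p = 2 \<or> length p = 3"
    by arith
  then consider u where "p = [u]" | u v where "p = [u, v]" | u v w where "p = [u, v, w]"
    by (auto simp: length_Suc_conv numeral_eq_Suc)
  then show "z \<in> neighbors G x \<union> (\<Union>y\<in>neighbors G x. neighbors G y - {x})"
    using p(1-3) ab(1,2)
    by cases (auto simp: walk_def neighbors_def doubleton_eq_iff insert_commute)
qed

lemma sum_square_degrees_le:
  assumes G: "finite_graph G" and mad: "mad G \<le> 2 * real k" and k: "k > 0"
    and X: "X \<subseteq> verts G"
  shows "(\<Sum>x\<in>X. card (neighbors (square G) x \<inter> X))
    \<le> ((2 * k - 1) * max_degree G + 2 * k) * card X"
proof -
  define d where "d y = card (neighbors G y \<inter> X)" for y
  define T where "T = {y \<in> verts G. d y > k}"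
  have finV: "finite (verts G)"
    using G by (simp add: finite_graph_def)
  then have finX: "finite X"
    using X finite_subset by auto
  have d_le: "d y \<le> max_degree G" if "y \<in> verts G" for y
  proof -
    have "d y \<le> degree G y"
      using G by (auto simp: d_def degree_def finite_neighbors intro: card_mono)
    then show ?thesis
      using degree_le_max_degree[OF G that] by simp
  qed
  \<comment> \<open>Subtraction on naturals truncates, so \<open>d y - k\<close> is the positive
    part of the difference.\<close>
  have deg: "card (neighbors (square G) x \<inter> X) \<le> d x + (\<Sum>y\<in>neighbors G x. (k - 1) + (d y - k))"
    if x: "x \<in> X" for x
  proof -
    have "neighbors (square G) x \<inter> X
        \<subseteq> (neighbors G x \<inter> X) \<union> (\<Union>y\<in>neighbors G x. neighbors G y \<inter> X - {x})"
      using neighbors_square_subset[of G x] by auto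
    then have "card (neighbors (square G) x \<inter> X)
        \<le> card ((neighbors G x \<inter> X) \<union> (\<Union>y\<in>neighbors G x. neighbors G y \<inter> X - {x}))"
      using finX G by (intro card_mono) (auto simp: finite_neighbors)
    also have "\<dots> \<le> d x + card (\<Union>y\<in>neighbors G x. neighbors G y \<inter> X - {x})"
      unfolding d_def by (rule card_Un_le)
    also have "card (\<Union>y\<in>neighbors G x. neighbors G y \<inter> X - {x})
        \<le> (\<Sum>y\<in>neighbors G x. card (neighbors G y \<inter> X - {x}))"
      using G by (intro card_UN_le finite_neighbors)
    also have "\<dots> \<le> (\<Sum>y\<in>neighbors G x. (k - 1) + (d y - k))"
    proof (rule sum_mono)
      fix y
      assume "y \<in> neighbors G x"
      then have "x \<in> neighbors G y \<inter> X"
        using x X neighbors_sym by fastforce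
      then have "card (neighbors G y \<inter> X - {x}) = d y - 1"
        by (simp add: d_def)
      then show "card (neighbors G y \<inter> X - {x}) \<le> (k - 1) + (d y - k)"
        using k by simp
    qed
    finally show ?thesis
      by simp
  qed
  have "(\<Sum>x\<in>X. d x) \<le> 2 * k * card X"
    using sum_card_neighbors_le_mad[OF G mad X X] by (simp add: d_def algebra_simps)
  moreover have "(\<Sum>x\<in>X. \<Sum>y\<in>neighbors G x. k - 1) \<le> (k - 1) * max_degree G * card X"
  proof -
    have "(\<Sum>x\<in>X. \<Sum>y\<in>neighbors G x. k - 1) \<le> (\<Sum>x\<in>X. max_degree G * (k - 1))"
      using degree_le_max_degree[OF G] X by (intro sum_mono) (auto simp: degree_def)
    then show ?thesis
      by (simp add: mult_ac)
  qed
  moreover have "(\<Sum>x\<in>X. \<Sum>y\<in>neighbors G x. d y - k) \<le> k * max_degree G * card X"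
  proof -
    have "(\<Sum>x\<in>X. \<Sum>y\<in>neighbors G x. d y - k)
        = (\<Sum>x\<in>X. \<Sum>y | y \<in> verts G \<and> {x, y} \<in> edges G. d y - k)"
      by (simp add: neighbors_def)
    \<comment> \<open>After the exchange each middle vertex \<open>y\<close> occurs once for each of
      its \<open>d y\<close> neighbors in \<open>X\<close>.\<close>
    also have "\<dots> = (\<Sum>y\<in>verts G. \<Sum>x | x \<in> X \<and> {x, y} \<in> edges G. d y - k)"
      by (rule sum.swap_restrict[OF finX finV])
    also have "\<dots> = (\<Sum>y\<in>verts G. d y * (d y - k))"
    proof (rule sum.cong[OF refl])
      fix y
      have "{x. x \<in> X \<and> {x, y} \<in> edges G} = neighbors G y \<inter> X"
        using X by (auto simp: neighbors_def insert_commute)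
      then show "(\<Sum>x | x \<in> X \<and> {x, y} \<in> edges G. d y - k) = d y * (d y - k)"
        by (simp add: d_def)
    qed
    also have "\<dots> \<le> (\<Sum>y\<in>verts G. max_degree G * (d y - k))"
      using d_le by (intro sum_mono mult_right_mono) auto
    also have "\<dots> = max_degree G * (\<Sum>y\<in>verts G. d y - k)"
      by (simp add: sum_distrib_left)
    also have "(\<Sum>y\<in>verts G. d y - k) = (\<Sum>y\<in>T. d y - k)"
      by (rule sum.mono_neutral_right) (use finV in \<open>auto simp: T_def\<close>)
    also have "(\<Sum>y\<in>T. d y - k) \<le> k * card X"
    proof -
      \<comment> \<open>On \<open>T\<close> nothing is truncated, and the added
        \<open>k * card T\<close> is exactly the share of \<open>T\<close> in the bound on pairs.
        This is why the threshold is \<open>k\<close>.\<close>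
      have "(\<Sum>y\<in>T. d y - k) + k * card T = (\<Sum>y\<in>T. (d y - k) + k)"
        by (simp only: sum.distrib sum_constant) (simp add: mult.commute)
      also have "\<dots> = (\<Sum>y\<in>T. d y)"
        by (rule sum.cong) (auto simp: T_def)
      also have "\<dots> \<le> k * (card X + card T)"
        using sum_card_neighbors_le_mad[OF G mad X, of T] by (simp add: d_def T_def)
      finally show ?thesis
        by (simp add: algebra_simps)
    qed
    finally show ?thesis
      by (simp add: mult_ac)
  qed
  moreover have "(\<Sum>x\<in>X. card (neighbors (square G) x \<inter> X)) \<le> (\<Sum>x\<in>X. d x)
      + (\<Sum>x\<in>X. \<Sum>y\<in>neighbors G x. k - 1) + (\<Sum>x\<in>X. \<Sum>y\<in>neighbors G x. d y - k)"
    using sum_mono[of X, OF deg] by (simp only: sum.distrib add.assoc)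
  ultimately have "(\<Sum>x\<in>X. card (neighbors (square G) x \<inter> X))
      \<le> 2 * k * card X + (k - 1) * max_degree G * card X + k * max_degree G * card X"
    by linarith
  also have "\<dots> = (((k - 1) + k) * max_degree G + 2 * k) * card X"
    by (simp only: algebra_simps)
  also have "(k - 1) + k = 2 * k - 1"
    using k by simp
  finally show ?thesis .
qed

text \<open>Some vertex does not exceed the average. Ranging over all \<open>X\<close>, this is the
  hypothesis of \<open>exists_greedy_order\<close>.\<close>

lemma exists_low_degree_in_square:
  assumes "finite_graph G" "mad G \<le> 2 * real k" "k > 0" "X \<subseteq> verts G" "X \<noteq> {}"
  shows "\<exists>x\<in>X. card (neighbors (square G) x \<inter> X) \<le> (2 * k - 1) * max_degree G + 2 * k"
proof (rule ccontr)
  assume "\<not> ?thesis"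
  moreover have "finite X"
    using assms by (auto simp: finite_graph_def intro: finite_subset)
  ultimately have "(\<Sum>x\<in>X. (2 * k - 1) * max_degree G + 2 * k)
      < (\<Sum>x\<in>X. card (neighbors (square G) x \<inter> X))"
    using assms by (intro sum_strict_mono) (auto simp: not_le)
  then show False
    using sum_square_degrees_le[OF assms(1-4)] by (simp add: mult.commute)
qed

section \<open>Greedy orderings and the coloring number\<close>

lemma linear_order_on_insert_last:
  assumes r: "linear_order_on A r" and x: "x \<notin> A"
  shows "linear_order_on (insert x A) (r \<union> insert x A \<times> {x})"
proof -
  have r': "r \<subseteq> A \<times> A" "refl_on A r" "trans r" "antisym r" "total_on A r"
    using r by (auto simp: linear_order_on_def partial_order_on_def preorder_on_def refl_on_def)
  have "refl_on (insert x A) (r \<union> insert x A \<times> {x})"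
    using r'(1,2) by (auto simp: refl_on_def)
  moreover have "trans (r \<union> insert x A \<times> {x})"
    using r'(1) x by (intro transI) (auto dest: transD[OF r'(3)])
  moreover have "antisym (r \<union> insert x A \<times> {x})"
    using r'(1) x by (intro antisymI) (auto dest: antisymD[OF r'(4)])
  moreover have "total_on (insert x A) (r \<union> insert x A \<times> {x})"
    using r'(5) by (auto simp: total_on_def)
  moreover have "r \<union> insert x A \<times> {x} \<subseteq> insert x A \<times> insert x A"
    using r'(1) by auto
  ultimately show ?thesis
    by (simp add: linear_order_on_def partial_order_on_def preorder_on_def)
qed

text \<open>Remove a vertex of low degree, order the rest by induction and put the removed vertex
  last. The extra 1 counts the vertex itself in its closed neighborhood.\<close>

lemma exists_greedy_order:
  assumes "finite X"
    and "\<And>Y. Y \<subseteq> X \<Longrightarrow> Y \<noteq> {} \<Longrightarrow> \<exists>x\<in>Y. card (neighbors H x \<inter> Y) \<le> D"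
  shows "\<exists>r. linear_order_on X r \<and>
    (\<forall>x\<in>X. card (closed_neighbors H x \<inter> {y. (y, x) \<in> r}) \<le> D + 1)"
  using assms
proof (induction X rule: finite_psubset_induct)
  case (psubset X)
  show ?case
  proof (cases "X = {}")
    case True
    then show ?thesis
      by (auto intro: exI[of _ "{}"])
  next
    case False
    then obtain x where x: "x \<in> X" "card (neighbors H x \<inter> X) \<le> D"
      using psubset.prems by blast
    have "X - {x} \<subset> X"
      using x by auto
    then obtain r where r: "linear_order_on (X - {x}) r"
      and D: "\<forall>z\<in>X - {x}. card (closed_neighbors H z \<inter> {y. (y, z) \<in> r}) \<le> D + 1"
      using psubset.IH[of "X - {x}"] psubset.prems by (meson order.trans psubset_imp_subset)
    define r' where "r' = r \<union> X \<times> {x}"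
    have rX: "r \<subseteq> (X - {x}) \<times> (X - {x})"
      using r by (auto simp: linear_order_on_def partial_order_on_def preorder_on_def refl_on_def)
    have "linear_order_on X r'"
      using linear_order_on_insert_last[OF r, of x] x(1) by (simp add: r'_def insert_absorb)
    moreover have "card (closed_neighbors H z \<inter> {y. (y, z) \<in> r'}) \<le> D + 1" if z: "z \<in> X" for z
    proof (cases "z = x")
      case True
      have "closed_neighbors H z \<inter> {y. (y, z) \<in> r'} \<subseteq> insert x (neighbors H x \<inter> X)"
        using True rX by (auto simp: closed_neighbors_def r'_def)
      then have "card (closed_neighbors H z \<inter> {y. (y, z) \<in> r'})
          \<le> card (insert x (neighbors H x \<inter> X))"
        using psubset.hyps by (intro card_mono) auto
      also have "\<dots> \<le> D + 1"
        using x(2) by (auto simp: card_insert_if psubset.hyps)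
      finally show ?thesis .
    next
      case False
      \<comment> \<open>Every new pair ends in \<open>x\<close>, so the other vertices gain no
        predecessors.\<close>
      then have "{y. (y, z) \<in> r'} = {y. (y, z) \<in> r}"
        by (auto simp: r'_def)
      then show ?thesis
        using D z False by auto
    qed
    ultimately show ?thesis
      by blast
  qed
qed

text \<open>One ordering bounds the minimum, because the linear orders on a finite vertex set are
  finite in number.\<close>

lemma col_le:
  assumes fin: "finite (verts H)" and r: "linear_order_on (verts H) r"
    and D: "\<And>x. x \<in> verts H \<Longrightarrow> card (closed_neighbors H x \<inter> {y. (y, x) \<in> r}) \<le> D"
  shows "col H \<le> D"
proof (cases "verts H = {}")
  case True
  then show ?thesis
    by (simp add: col_def)
next
  case False
  define m where
    "m r = Max ((\<lambda>x. card (closed_neighbors H x \<inter> {y. (y, x) \<in> r})) ` verts H)" for r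
  have "{r. linear_order_on (verts H) r} \<subseteq> Pow (verts H \<times> verts H)"
    by (auto simp: linear_order_on_def partial_order_on_def preorder_on_def refl_on_def)
  then have "finite {r. linear_order_on (verts H) r}"
    by (rule finite_subset) (use fin in auto)
  then have "finite {m r | r. linear_order_on (verts H) r}"
    by simp
  then have "Min {m r | r. linear_order_on (verts H) r} \<le> m r"
    using r by (intro Min_le) auto
  also have "m r \<le> D"
    unfolding m_def using fin False D by (subst Max_le_iff) auto
  finally show ?thesis
    using False by (simp add: col_def m_def)
qed

theorem theorem3p8:
  fixes k :: int and G :: "'a ugraph"
  assumes "k > 0"
    and "finite_graph G"
    and "2 * real_of_int k - 2 < mad G"
    and "mad G \<le> 2 * real_of_int k"
  shows "int (col (square G)) \<le> (2 * k - 1) * int (max_degree G) + 2 * k + 1"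
proof -
  define n where "n = nat k"
  have n: "k = int n" "n > 0"
    using assms(1) by (auto simp: n_def)
  define D where "D = (2 * n - 1) * max_degree G + 2 * n"
  have verts: "verts (square G) = verts G"
    by (simp add: square_def)
  have fin: "finite (verts G)"
    using assms(2) by (simp add: finite_graph_def)
  have "\<exists>x\<in>Y. card (neighbors (square G) x \<inter> Y) \<le> D" if "Y \<subseteq> verts G" "Y \<noteq> {}" for Y
    unfolding D_def using assms(2,4) n that by (intro exists_low_degree_in_square) auto
  then obtain r where "linear_order_on (verts G) r"
    "\<forall>x\<in>verts G. card (closed_neighbors (square G) x \<inter> {y. (y, x) \<in> r}) \<le> D + 1"
    using exists_greedy_order[OF fin, of "square G" D] by blast
  then have "col (square G) \<le> D + 1"
    using fin by (intro col_le) (auto simp: verts)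
  \<comment> \<open>Since \<open>n > 0\<close>, the natural number \<open>2 * n - 1\<close> is not
    truncated and agrees with the integer \<open>2 * k - 1\<close>.\<close>
  moreover have "int D = (2 * k - 1) * int (max_degree G) + 2 * k"
    using n by (simp add: D_def)
  ultimately show ?thesis
    by linarith
qed

end
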